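(* Let $G$ be a finite group, let $a,b,c$ be non-identity elements of $G$ and let $A=\langle a\rangle$, $B=\langle b\rangle$, $C=\langle c\rangle$. Suppose that $abc=1$, that $|A\cap B|=|A\cap C|=|B\cap C|=1$, and that $G=\langle a,b,c\rangle$. Let $(T^{\circ},T^{\star})$ be the latin bitrade $$T^{\circ}=\{(gA,gB,gC)\mid g\in G\},\qquad T^{\star}=\{(gA,gB,ga^{-1}C)\mid g\in G\}.$$ Then $(T^{\circ},T^{\star})$ is orthogonal if and only if $|C\cap C^{a}|=1$, where $C^{a}=a^{-1}Ca$.
   Context: Let $A_1,A_2,A_3$ be finite, non-empty, pairwise disjoint sets (of rows, columns and symbols, respectively). A partial latin square is a subset $T\subseteq A_1\times A_2\times A_3$ such that (P1) if $(a_1,a_2,a_3),(b_1,b_2,b_3)\in T$ then either at most one of $a_1=b_1$, $a_2=b_2$, $a_3=b_3$ is true or all three are true; (P2) every $\alpha\in A_1\cup A_2\cup A_3$ occurs as a coordinate of some element of $T$. A latin bitrade is a pair $(T^{\circ},T^{\star})$ of partial latin squares $T^{\circ},T^{\star}\subset A_1\times A_2\times A_3$ such that (R1) $T^{\circ}\cap T^{\star}=\emptyset$; (R2) for all $(a_1,a_2,a_3)\in T^{\circ}$ and all $r\ne s$ in $\{1,2,3\}$ there is a unique $(b_1,b_2,b_3)\in T^{\star}$ with $a_r=b_r$ and $a_s=b_s$; (R3) the same as (R2) with $T^{\circ}$ and $T^{\star}$ interchanged. Under the hypotheses of the claim the given pair is a latin bitrade, with $A_1,A_2,A_3$ the sets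 of left cosets in $G$ of $A,B,C$ respectively. Write $i\circ j=k$ for $(i,j,k)\in T^{\circ}$ and $i\star j=k$ for $(i,j,k)\in T^{\star}$. The latin bitrade $(T^{\circ},T^{\star})$ is orthogonal if whenever $i\circ j=i'\circ j'$ with $i\ne i'$, $j\ne j'$, then $i\star j\ne i'\star j'$. *)

theory Defs
  imports "HOL-Algebra.Left_Coset" "HOL-Algebra.Generated_Groups"
begin

definition coord :: "nat \<Rightarrow> 'a \<times> 'a \<times> 'a \<Rightarrow> 'a" where
  "coord r t = (if r = 1 then fst t else if r = 2 then fst (snd t) else snd (snd t))"

definition partial_latin_square ::
    "'a set \<Rightarrow> 'a set \<Rightarrow> 'a set \<Rightarrow> ('a \<times> 'a \<times> 'a) set \<Rightarrow> bool" where
  "partial_latin_square A1 A2 A3 T \<longleftrightarrow>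
     finite A1 \<and> finite A2 \<and> finite A3 \<and>
     A1 \<noteq> {} \<and> A2 \<noteq> {} \<and> A3 \<noteq> {} \<and>
     A1 \<inter> A2 = {} \<and> A1 \<inter> A3 = {} \<and> A2 \<inter> A3 = {} \<and>
     T \<subseteq> A1 \<times> A2 \<times> A3 \<and>
     (\<forall>s\<in>T. \<forall>t\<in>T.
        card {r \<in> {1, 2, 3}. coord r s = coord r t} \<le> 1 \<or>
        (\<forall>r\<in>{1, 2, 3}. coord r s = coord r t)) \<and>
     (\<forall>x \<in> A1 \<union> A2 \<union> A3. \<exists>t\<in>T. \<exists>r\<in>{1, 2, 3}. coord r t = x)"

definition latin_bitrade ::
    "'a set \<Rightarrow> 'a set \<Rightarrow> 'a set \<Rightarrow> ('a \<times> 'a \<times> 'a) set \<Rightarrow> ('a \<times> 'a \<times> 'a) set \<Rightarrow> bool" where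
  "latin_bitrade A1 A2 A3 T U \<longleftrightarrow>
     partial_latin_square A1 A2 A3 T \<and> partial_latin_square A1 A2 A3 U \<and>
     T \<inter> U = {} \<and>
     (\<forall>s\<in>T. \<forall>p\<in>{1, 2, 3}. \<forall>q\<in>{1, 2, 3}. p \<noteq> q \<longrightarrow>
        (\<exists>!t. t \<in> U \<and> coord p s = coord p t \<and> coord q s = coord q t)) \<and>
     (\<forall>s\<in>U. \<forall>p\<in>{1, 2, 3}. \<forall>q\<in>{1, 2, 3}. p \<noteq> q \<longrightarrow>
        (\<exists>!t. t \<in> T \<and> coord p s = coord p t \<and> coord q s = coord q t))"

text \<open>The two operations are partial and are read as relations: the first product of \<open>i\<close> and \<open>j\<close>
  is \<open>k\<close> iff \<open>(i, j, k) \<in> T\<close>, the second is \<open>l\<close> iff \<open>(i, j, l) \<in> U\<close>. In a latin bitrade both are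
  single-valued and have the same domain, so the second products in the conclusion exist whenever
  the first ones do.\<close>

definition orthogonal_bitrade :: "('a \<times> 'a \<times> 'a) set \<Rightarrow> ('a \<times> 'a \<times> 'a) set \<Rightarrow> bool" where
  "orthogonal_bitrade T U \<longleftrightarrow>
     (\<forall>i j i' j' k l l'.
        (i, j, k) \<in> T \<and> (i', j', k) \<in> T \<and> i \<noteq> i' \<and> j \<noteq> j' \<and>
        (i, j, l) \<in> U \<and> (i', j', l') \<in> U \<longrightarrow> l \<noteq> l')"

definition coset_circ ::
    "('g, 'm) monoid_scheme \<Rightarrow> 'g set \<Rightarrow> 'g set \<Rightarrow> 'g set \<Rightarrow> ('g set \<times> 'g set \<times> 'g set) set" where
  "coset_circ G A B C =
     {(g <#\<^bsub>G\<^esub> A, g <#\<^bsub>G\<^esub> B, g <#\<^bsub>G\<^esub> C) | g. g \<in> carrier G}"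

definition coset_star ::
    "('g, 'm) monoid_scheme \<Rightarrow> 'g \<Rightarrow> 'g set \<Rightarrow> 'g set \<Rightarrow> 'g set \<Rightarrow> ('g set \<times> 'g set \<times> 'g set) set" where
  "coset_star G a A B C =
     {(g <#\<^bsub>G\<^esub> A, g <#\<^bsub>G\<^esub> B, (g \<otimes>\<^bsub>G\<^esub> inv\<^bsub>G\<^esub> a) <#\<^bsub>G\<^esub> C) | g. g \<in> carrier G}"

definition conj_subset :: "('g, 'm) monoid_scheme \<Rightarrow> 'g set \<Rightarrow> 'g \<Rightarrow> 'g set" where
  "conj_subset G H x = {inv\<^bsub>G\<^esub> x \<otimes>\<^bsub>G\<^esub> h \<otimes>\<^bsub>G\<^esub> x | h. h \<in> H}"

lemma (in group) lcos_eq_iff: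
  assumes "subgroup H G" "x \<in> carrier G" "y \<in> carrier G"
  shows "x <# H = y <# H \<longleftrightarrow> inv y \<otimes> x \<in> H"
proof
  assume "x <# H = y <# H"
  then have "x \<in> y <# H" using lcos_self[OF assms(2,1)] by simp
  then show "inv y \<otimes> x \<in> H"
    using subgroup.lcos_module_imp[OF assms(1) is_group assms(3)] by simp
next
  assume "inv y \<otimes> x \<in> H"
  then have "x \<in> y <# H"
    using subgroup.lcos_module_rev[OF assms(1) is_group assms(3,2)] by simp
  then show "x <# H = y <# H"
    using l_repr_independence[OF _ assms(3,1)] by simp
qed

lemma coord_simps [simp]:
  "coord 1 (x, y, z) = x" "coord (Suc 0) (x, y, z) = x" "coord 2 (x, y, z) = y" "coord 3 (x, y, z) = z"
  by (simp_all add: coord_def)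

lemma partial_latin_squareI:
  assumes "finite A1" "finite A2" "finite A3" "A1 \<noteq> {}" "A2 \<noteq> {}" "A3 \<noteq> {}"
    and "A1 \<inter> A2 = {}" "A1 \<inter> A3 = {}" "A2 \<inter> A3 = {}" "T \<subseteq> A1 \<times> A2 \<times> A3"
    and inj: "\<And>s t p q. \<lbrakk>s \<in> T; t \<in> T; p \<in> {1, 2, 3}; q \<in> {1, 2, 3}; p \<noteq> q;
      coord p s = coord p t; coord q s = coord q t\<rbrakk> \<Longrightarrow> s = t"
    and "\<And>x. x \<in> A1 \<union> A2 \<union> A3 \<Longrightarrow> \<exists>t\<in>T. \<exists>r\<in>{1, 2, 3}. coord r t = x"
  shows "partial_latin_square A1 A2 A3 T"
proof -
  have "card {r \<in> {1, 2, 3}. coord r s = coord r t} \<le> 1 \<or>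
        (\<forall>r\<in>{1, 2, 3}. coord r s = coord r t)" if "s \<in> T" "t \<in> T" for s t
  proof (cases "s = t")
    case False
    then have "card {r \<in> {1, 2, 3::nat}. coord r s = coord r t} \<le> 1"
      by (subst One_nat_def, subst card_le_Suc0_iff_eq)
        (use inj[OF that] in \<open>simp, blast\<close>)
    then show ?thesis ..
  qed simp
  then show ?thesis
    unfolding partial_latin_square_def by (intro conjI ballI assms(1-10,12))
qed

lemma coset_latin_bitrade:
  fixes G (structure)
  assumes "group G" and fin: "finite (carrier G)"
    and car: "a \<in> carrier G" "b \<in> carrier G" "c \<in> carrier G"
    and non: "a \<noteq> \<one>" "b \<noteq> \<one>" "c \<noteq> \<one>"
    and A: "A = generate G {a}" and B: "B = generate G {b}" and C: "C = generate G {c}"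
    and abc: "a \<otimes> b \<otimes> c = \<one>"
    and cards: "card (A \<inter> B) = 1" "card (A \<inter> C) = 1" "card (B \<inter> C) = 1"
  shows "latin_bitrade (lcosets A) (lcosets B) (lcosets C) (coset_circ G A B C) (coset_star G a A B C)"
proof -
  interpret group G by fact
  have sg: "subgroup A G" "subgroup B G" "subgroup C G"
    using car unfolding A B C by (auto intro: generate_is_subgroup)
  have mem: "a \<in> A" "b \<in> B" "c \<in> C"
    unfolding A B C by (auto intro: generate.incl)
  have triv: "x = \<one>" if "x \<in> A \<and> x \<in> B \<or> x \<in> A \<and> x \<in> C \<or> x \<in> B \<and> x \<in> C" for x
  proof -
    have "\<one> \<in> A" "\<one> \<in> B" "\<one> \<in> C" using sg by (auto simp: subgroup.one_closed)
    moreover have "u = v" if "card X = 1" "u \<in> X" "v \<in> X" for X :: "'a set" and u v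
      using that by (auto simp: card_1_singleton_iff)
    ultimately show ?thesis using that cards by (meson IntI)
  qed
  have inc: "x \<in> carrier G" if "x \<in> A \<or> x \<in> B \<or> x \<in> C" for x
    using that sg by (auto dest: subgroup.mem_carrier)
  note lc = lcos_eq_iff[OF sg(1)] lcos_eq_iff[OF sg(2)] lcos_eq_iff[OF sg(3)]
  have eqI: "g = h" if "inv h \<otimes> g = \<one>" "g \<in> carrier G" "h \<in> carrier G" for g h
    using that inv_equality[of "inv h" g] by (metis inv_closed inv_inv)
  define F where "F = (\<lambda>g. (g <# A, g <# B, g <# C))"
  define S where "S = (\<lambda>g. (g <# A, g <# B, (g \<otimes> inv a) <# C))"
  have circ: "coset_circ G A B C = F ` carrier G" and star: "coset_star G a A B C = S ` carrier G"
    by (auto simp: coset_circ_def coset_star_def F_def S_def)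
  have Fin: "g = h" if "g \<in> carrier G" "h \<in> carrier G" "p \<in> {1, 2, 3}" "q \<in> {1, 2, 3}" "p \<noteq> q"
     "coord p (F g) = coord p (F h)" "coord q (F g) = coord q (F h)" for g h p q
    by (rule eqI, rule triv) (use that in \<open>auto simp: F_def lc\<close>)
  have cancel: "inv x \<otimes> (x \<otimes> y) = y" "x \<otimes> (inv x \<otimes> y) = y"
    if "x \<in> carrier G" "y \<in> carrier G" for x y
    using that by (simp_all add: m_assoc[symmetric])
  have b_eq: "inv a \<otimes> inv c = b"
  proof -
    have "inv c = a \<otimes> b" using inv_equality[of "a \<otimes> b" c] abc car by auto
    then show ?thesis using car by (simp add: m_assoc[symmetric])
  qed
  have bc: "b \<otimes> c = inv a" 
  proof -
    have "a \<otimes> (b \<otimes> c) = \<one>" using abc car by (simp add: m_assoc)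
    then have "(b \<otimes> c) \<otimes> a = \<one>" using inv_comm[of a "b \<otimes> c"] car by auto
    then show ?thesis using inv_equality[of "b \<otimes> c" a] car by auto
  qed
  have ba: "inv b \<otimes> inv a = c"
    using car by (simp add: bc[symmetric] m_assoc[symmetric])
  have cb: "a = inv c \<otimes> inv b" using bc car by (metis inv_inv inv_mult_group)
  have conjA: "x = \<one>" if "x \<in> A" "a \<otimes> x \<otimes> inv a \<in> C" for x
  proof -
    have "a \<otimes> x \<otimes> inv a \<in> A"
      using sg(1) mem(1) that(1) by (simp add: subgroup.m_closed subgroup.m_inv_closed)
    then have "a \<otimes> x \<otimes> inv a = \<one>" using triv that by blast
    then have "inv a \<otimes> (a \<otimes> x \<otimes> inv a) \<otimes> a = inv a \<otimes> \<one> \<otimes> a" by simp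
    moreover have "x \<in> carrier G" using inc that(1) by blast
    ultimately show ?thesis using car by (simp add: m_assoc cancel)
  qed
  have conjB: "x = \<one>" if "x \<in> B" "a \<otimes> x \<otimes> inv a \<in> C" for x
  proof -
    have x: "x \<in> carrier G" using inc that by blast
    let ?y = "inv b \<otimes> x \<otimes> b"
    have yB: "?y \<in> B"
      using sg(2) mem(2) that(1) by (simp add: subgroup.m_closed subgroup.m_inv_closed)
    have "c \<otimes> (a \<otimes> x \<otimes> inv a) \<otimes> inv c \<in> C"
      using sg(3) mem(3) that(2) by (simp add: subgroup.m_closed subgroup.m_inv_closed)
    moreover have "c \<otimes> (a \<otimes> x \<otimes> inv a) \<otimes> inv c = (c \<otimes> a) \<otimes> x \<otimes> (inv a \<otimes> inv c)"
      using car x by (simp add: m_assoc)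
    moreover have "c \<otimes> a = inv b"
      using cb car by (simp add: m_assoc[symmetric])
    ultimately have "?y \<in> C" using b_eq by simp
    then have "?y = \<one>" using triv yB by blast
    then have "b \<otimes> ?y \<otimes> inv b = b \<otimes> \<one> \<otimes> inv b" by simp
    then show ?thesis using car x by (simp add: m_assoc cancel)
  qed
  have conj: "inv (h \<otimes> inv a) \<otimes> (g \<otimes> inv a) = a \<otimes> (inv h \<otimes> g) \<otimes> inv a"
    if "g \<in> carrier G" "h \<in> carrier G" for g h
    using that car by (simp add: inv_mult_group m_assoc)
  have Sin: "g = h" if "g \<in> carrier G" "h \<in> carrier G" "p \<in> {1, 2, 3}" "q \<in> {1, 2, 3}" "p \<noteq> q"
     "coord p (S g) = coord p (S h)" "coord q (S g) = coord q (S h)" for g h p q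
  proof (rule eqI)
    have "(inv h \<otimes> g \<in> A \<and> inv h \<otimes> g \<in> B) \<or> (inv h \<otimes> g \<in> A \<and> a \<otimes> (inv h \<otimes> g) \<otimes> inv a \<in> C)
       \<or> (inv h \<otimes> g \<in> B \<and> a \<otimes> (inv h \<otimes> g) \<otimes> inv a \<in> C)"
      using that car by (auto simp: S_def lc conj)
    then show "inv h \<otimes> g = \<one>" using triv conjA conjB by blast
  qed (use that in auto)
  have self: "g \<in> g <# X" if "X \<in> {A, B, C}" "g \<in> carrier G" for X g
    using that sg lcos_self by blast
  have dis: "X = Y" if XY: "X \<in> {A, B, C}" "Y \<in> {A, B, C}" and eq: "g <# X = h <# Y"
     and gh: "g \<in> carrier G" "h \<in> carrier G" for X Y g h
  proof -
    have X: "subgroup X G" and Y: "subgroup Y G" using XY sg by auto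
    have "g \<in> h <# Y" using eq self[OF XY(1) gh(1)] by simp
    then have "h <# Y = g <# Y" using l_repr_independence[OF _ gh(2) Y] by simp
    then have "g <# X = g <# Y" using eq by simp
    then have "inv g <# (g <# X) = inv g <# (g <# Y)" by simp
    then show ?thesis
      using gh X Y by (simp add: lcos_m_assoc subgroup.subset lcos_mult_one)
  qed
  have ne: "A \<noteq> B" "A \<noteq> C" "B \<noteq> C" using triv mem non by blast+
  have disj: "lcosets A \<inter> lcosets B = {}" "lcosets A \<inter> lcosets C = {}" "lcosets B \<inter> lcosets C = {}"
  proof -
    have "lcosets X \<inter> lcosets Y = {}" if XY: "X \<in> {A, B, C}" "Y \<in> {A, B, C}" "X \<noteq> Y" for X Y
    proof (rule ccontr)
      assume "lcosets X \<inter> lcosets Y \<noteq> {}"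
      then obtain g h where "g \<in> carrier G" "h \<in> carrier G" "g <# X = h <# Y"
        by (auto simp: LCOSETS_def)
      then show False using dis[OF XY(1,2)] XY(3) by blast
    qed
    then show "lcosets A \<inter> lcosets B = {}" "lcosets A \<inter> lcosets C = {}" "lcosets B \<inter> lcosets C = {}"
      using ne by blast+
  qed
  have finL: "finite (lcosets X)" "lcosets X \<noteq> {}" for X
    using fin by (auto simp: LCOSETS_def)
  have pF: "partial_latin_square (lcosets A) (lcosets B) (lcosets C) (F ` carrier G)"
  proof (rule partial_latin_squareI)
    show "F ` carrier G \<subseteq> (lcosets A) \<times> (lcosets B) \<times> (lcosets C)"
      by (auto simp: F_def LCOSETS_def)
    show "s = t" if "s \<in> F ` carrier G" "t \<in> F ` carrier G" "p \<in> {1, 2, 3}" "q \<in> {1, 2, 3}" "p \<noteq> q"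
      "coord p s = coord p t" "coord q s = coord q t" for s t p q
      using that Fin by blast
    show "\<exists>t\<in>F ` carrier G. \<exists>r\<in>{1, 2, 3}. coord r t = x"
      if "x \<in> lcosets A \<union> lcosets B \<union> lcosets C" for x
      using that by (auto simp: LCOSETS_def F_def)
  qed (use finL disj in auto)
  have pS: "partial_latin_square (lcosets A) (lcosets B) (lcosets C) (S ` carrier G)"
  proof (rule partial_latin_squareI)
    show "S ` carrier G \<subseteq> (lcosets A) \<times> (lcosets B) \<times> (lcosets C)"
    proof -
      have "g <# X \<in> lcosets X" if "g \<in> carrier G" for g X
        using that unfolding LCOSETS_def by blast
      then show ?thesis using car by (auto simp: S_def)
    qed
    show "s = t" if "s \<in> S ` carrier G" "t \<in> S ` carrier G" "p \<in> {1, 2, 3}" "q \<in> {1, 2, 3}" "p \<noteq> q"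
      "coord p s = coord p t" "coord q s = coord q t" for s t p q
      using that Sin by blast
    show "\<exists>t\<in>S ` carrier G. \<exists>r\<in>{1, 2, 3}. coord r t = x"
      if x: "x \<in> lcosets A \<union> lcosets B \<union> lcosets C" for x
    proof -
      obtain g where g: "g \<in> carrier G" "x = g <# A \<or> x = g <# B \<or> x = g <# C"
        using x by (auto simp: LCOSETS_def)
      have "coord 1 (S g) = g <# A" "coord 2 (S g) = g <# B" "coord 3 (S (g \<otimes> a)) = g <# C"
        using g(1) car by (auto simp: S_def m_assoc)
      then have "x = coord 1 (S g) \<or> x = coord 2 (S g) \<or> x = coord 3 (S (g \<otimes> a))"
        using g(2) by metis
      moreover have "g \<otimes> a \<in> carrier G" using g(1) car by simp
      ultimately show ?thesis using g(1) by blast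
    qed
  qed (use finL disj in auto)
  have notin: "a \<notin> C" using triv mem non by blast
  have "F g \<noteq> S h" if gh: "g \<in> carrier G" "h \<in> carrier G" for g h
  proof
    assume *: "F g = S h"
    then have "g = h" by (intro eqI[OF triv gh]) (use gh in \<open>auto simp: F_def S_def lc\<close>)
    then have "inv (g \<otimes> inv a) \<otimes> g \<in> C" using * gh car by (auto simp: F_def S_def lc)
    then show False using gh car notin by (simp add: inv_mult_group m_assoc cancel)
  qed
  then have R1: "F ` carrier G \<inter> S ` carrier G = {}" by blast
  have R2: "\<exists>h\<in>carrier G. coord p (F g) = coord p (S h) \<and> coord q (F g) = coord q (S h)"
    if g: "g \<in> carrier G" and pq: "p \<in> {1, 2, 3}" "q \<in> {1, 2, 3}" "p \<noteq> q" for g p q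
  proof -
    have 1: "coord 1 (F g) = coord 1 (S g)" "coord 2 (F g) = coord 2 (S g)" by (auto simp: F_def S_def)
    have 2: "coord 1 (F g) = coord 1 (S (g \<otimes> a))" "coord 3 (F g) = coord 3 (S (g \<otimes> a))"
      using g car mem sg by (auto simp: F_def S_def lc inv_mult_group m_assoc cancel subgroup.m_inv_closed subgroup.one_closed)
    have 3: "coord 2 (F g) = coord 2 (S (g \<otimes> inv b))" "coord 3 (F g) = coord 3 (S (g \<otimes> inv b))"
      using g car mem sg ba by (auto simp: F_def S_def lc inv_mult_group m_assoc cancel subgroup.m_inv_closed subgroup.one_closed)
    have 4: "g \<otimes> a \<in> carrier G" "g \<otimes> inv b \<in> carrier G" using g car by auto
    have "p = 1 \<and> q = 2 \<or> p = 2 \<and> q = 1 \<or> p = 1 \<and> q = 3 \<or> p = 3 \<and> q = 1 \<or> p = 2 \<and> q = 3 \<or> p = 3 \<and> q = 2"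
      using pq by auto
    then show ?thesis using g 4 1 2 3 by blast
  qed
  have R3: "\<exists>h\<in>carrier G. coord p (S g) = coord p (F h) \<and> coord q (S g) = coord q (F h)"
    if g: "g \<in> carrier G" and pq: "p \<in> {1, 2, 3}" "q \<in> {1, 2, 3}" "p \<noteq> q" for g p q
  proof -
    have 1: "coord 1 (S g) = coord 1 (F g)" "coord 2 (S g) = coord 2 (F g)" by (auto simp: F_def S_def)
    have 2: "coord 1 (S g) = coord 1 (F (g \<otimes> inv a))" "coord 3 (S g) = coord 3 (F (g \<otimes> inv a))"
      using g car mem sg by (auto simp: F_def S_def lc inv_mult_group m_assoc cancel subgroup.m_inv_closed subgroup.one_closed)
    have 3: "coord 2 (S g) = coord 2 (F (g \<otimes> b))" "coord 3 (S g) = coord 3 (F (g \<otimes> b))"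
      using g car mem sg by (auto simp: F_def S_def lc inv_mult_group m_assoc cancel subgroup.m_inv_closed subgroup.one_closed bc[symmetric])
    have 4: "g \<otimes> inv a \<in> carrier G" "g \<otimes> b \<in> carrier G" using g car by auto
    have "p = 1 \<and> q = 2 \<or> p = 2 \<and> q = 1 \<or> p = 1 \<and> q = 3 \<or> p = 3 \<and> q = 1 \<or> p = 2 \<and> q = 3 \<or> p = 3 \<and> q = 2"
      using pq by auto
    then show ?thesis using g 4 1 2 3 by blast
  qed
  have R2': "\<exists>!t. t \<in> S ` carrier G \<and> coord p s = coord p t \<and> coord q s = coord q t"
    if s: "s \<in> F ` carrier G" and pq: "p \<in> {1, 2, 3}" "q \<in> {1, 2, 3}" "p \<noteq> q" for s p q
  proof -
    obtain g where g: "g \<in> carrier G" "s = F g" using s by blast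
    obtain h where h: "h \<in> carrier G" "coord p s = coord p (S h)" "coord q s = coord q (S h)"
      using R2[OF g(1) pq] g(2) by blast
    show ?thesis
    proof (rule ex1I[of _ "S h"])
      fix t assume "t \<in> S ` carrier G \<and> coord p s = coord p t \<and> coord q s = coord q t"
      then obtain k where k: "k \<in> carrier G" "t = S k"
          "coord p s = coord p (S k)" "coord q s = coord q (S k)"
        by blast
      have "k = h"
        by (rule Sin[OF k(1) h(1) pq]) (simp_all only: k(3,4)[symmetric] h(2,3)[symmetric])
      then show "t = S h" by (simp only: k(2))
    qed (use h in blast)
  qed
  have R3': "\<exists>!t. t \<in> F ` carrier G \<and> coord p s = coord p t \<and> coord q s = coord q t"
    if s: "s \<in> S ` carrier G" and pq: "p \<in> {1, 2, 3}" "q \<in> {1, 2, 3}" "p \<noteq> q" for s p q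
  proof -
    obtain g where g: "g \<in> carrier G" "s = S g" using s by blast
    obtain h where h: "h \<in> carrier G" "coord p s = coord p (F h)" "coord q s = coord q (F h)"
      using R3[OF g(1) pq] g(2) by blast
    show ?thesis
    proof (rule ex1I[of _ "F h"])
      fix t assume "t \<in> F ` carrier G \<and> coord p s = coord p t \<and> coord q s = coord q t"
      then obtain k where k: "k \<in> carrier G" "t = F k"
          "coord p s = coord p (F k)" "coord q s = coord q (F k)"
        by blast
      have "k = h"
        by (rule Fin[OF k(1) h(1) pq]) (simp_all only: k(3,4)[symmetric] h(2,3)[symmetric])
      then show "t = F h" by (simp only: k(2))
    qed (use h in blast)
  qed
  show ?thesis
    unfolding latin_bitrade_def circ star
    by (intro conjI ballI impI pF pS R1 R2' R3')
qed

end

theory Submission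
  imports Defs
begin

text \<open>Since \<open>A \<inter> B\<close> is trivial, a pair of cosets \<open>gA\<close>, \<open>gB\<close> determines \<open>g\<close>. Two cells with distinct rows,
  distinct columns and equal entries in both squares therefore come from \<open>g, h\<close> for which
  \<open>x = h\<inverse>g\<close> satisfies \<open>x \<in> C\<close>, \<open>axa\<inverse> \<in> C\<close>, \<open>x \<notin> A\<close> and \<open>x \<notin> B\<close>. The last two conditions amount
  to \<open>x \<noteq> 1\<close>, because \<open>C\<close> meets \<open>A\<close> and \<open>B\<close> trivially.\<close>

text \<open>Both subgroups contain \<open>\<one>\<close>, so an intersection with one element can
  only be \<open>{\<one>}\<close>. This turns the cardinality conditions into statements about
  single elements.\<close>

lemma (in group) subgroup_Int_trivial_iff:
  assumes "subgroup H G" "subgroup K G"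
  shows "card (H \<inter> K) = 1 \<longleftrightarrow> (\<forall>x\<in>H. x \<in> K \<longrightarrow> x = \<one>)"
proof -
  have "\<one> \<in> H \<inter> K" using assms by (simp add: subgroup.one_closed)
  then have "card (H \<inter> K) = 1 \<longleftrightarrow> H \<inter> K = {\<one>}"
    by (metis card_1_singletonE is_singletonI is_singleton_altdef singletonD)
  also have "\<dots> \<longleftrightarrow> (\<forall>x\<in>H. x \<in> K \<longrightarrow> x = \<one>)" using \<open>\<one> \<in> H \<inter> K\<close> by blast
  finally show ?thesis .
qed

text \<open>Solving \<open>x = inv y \<otimes> h \<otimes> y\<close> for \<open>h\<close> replaces
  the existential in \<open>conj_subset\<close> by a condition on \<open>x\<close> alone, the form
  in which equality of symbols in the second square appears.\<close>

lemma (in group) mem_conj_subset_iff: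
  assumes "H \<subseteq> carrier G" "y \<in> carrier G" "x \<in> carrier G"
  shows "x \<in> conj_subset G H y \<longleftrightarrow> y \<otimes> x \<otimes> inv y \<in> H"
proof
  assume "x \<in> conj_subset G H y"
  then obtain h where h: "h \<in> H" "x = inv y \<otimes> h \<otimes> y" by (auto simp: conj_subset_def)
  then have "h \<in> carrier G" using assms(1) by blast
  then have "y \<otimes> x \<otimes> inv y = y \<otimes> inv y \<otimes> h \<otimes> (y \<otimes> inv y)"
    using assms(2) by (simp only: h(2) m_assoc m_closed inv_closed)
  then have "y \<otimes> x \<otimes> inv y = h" using \<open>h \<in> carrier G\<close> assms(2) by simp
  then show "y \<otimes> x \<otimes> inv y \<in> H" using h(1) by simp
next
  assume H: "y \<otimes> x \<otimes> inv y \<in> H"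
  have "x = inv y \<otimes> (y \<otimes> x \<otimes> inv y) \<otimes> y"
    using assms(2,3) by (simp add: m_assoc inv_solve_left)
  then show "x \<in> conj_subset G H y" using H unfolding conj_subset_def by blast
qed

text \<open>The map sending \<open>x\<close> to \<open>y \<otimes> x \<otimes> inv y\<close>
  respects products and inverses, so closure is inherited from \<open>H\<close>. This allows
  \<open>subgroup_Int_trivial_iff\<close> to be applied to \<open>C\<close> and its
  conjugate.\<close>

lemma (in group) subgroup_conj_subset:
  assumes H: "subgroup H G" and y: "y \<in> carrier G"
  shows "subgroup (conj_subset G H y) G"
proof (rule subgroupI)
  have sub: "H \<subseteq> carrier G" using H by (rule subgroup.subset)
  show car: "conj_subset G H y \<subseteq> carrier G" using sub y by (auto simp: conj_subset_def)
  show "conj_subset G H y \<noteq> {}" using subgroup.one_closed[OF H] by (auto simp: conj_subset_def)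
  show "inv x \<in> conj_subset G H y" if "x \<in> conj_subset G H y" for x
  proof -
    have x: "x \<in> carrier G" using that car by blast
    have "inv (y \<otimes> x \<otimes> inv y) \<in> H"
      using that mem_conj_subset_iff[OF sub y x] subgroup.m_inv_closed[OF H] by blast
    then show ?thesis using x y by (simp add: mem_conj_subset_iff[OF sub y] inv_mult_group m_assoc)
  qed
  show "u \<otimes> v \<in> conj_subset G H y" if "u \<in> conj_subset G H y" "v \<in> conj_subset G H y" for u v
  proof -
    have u: "u \<in> carrier G" and v: "v \<in> carrier G" using that car by blast+
    have "(y \<otimes> u \<otimes> inv y) \<otimes> (y \<otimes> v \<otimes> inv y) \<in> H"
      using that mem_conj_subset_iff[OF sub y u] mem_conj_subset_iff[OF sub y v]
        subgroup.m_closed[OF H] by blast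
    moreover have "(y \<otimes> u \<otimes> inv y) \<otimes> (y \<otimes> v \<otimes> inv y) = y \<otimes> (u \<otimes> v) \<otimes> inv y"
      using u v y by (simp add: m_assoc inv_solve_left')
    ultimately show ?thesis using u v by (simp add: mem_conj_subset_iff[OF sub y])
  qed
qed

theorem lemma3p2:
  fixes G :: "('g, 'm) monoid_scheme" (structure)
    and a b c :: 'g and A B C :: "'g set"
  assumes "group G" and "finite (carrier G)"
    and "a \<in> carrier G" and "b \<in> carrier G" and "c \<in> carrier G"
    and "a \<noteq> \<one>" and "b \<noteq> \<one>" and "c \<noteq> \<one>"
    and "A = generate G {a}" and "B = generate G {b}" and "C = generate G {c}"
    and "a \<otimes> b \<otimes> c = \<one>"
    and "card (A \<inter> B) = 1" and "card (A \<inter> C) = 1" and "card (B \<inter> C) = 1"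
    and "carrier G = generate G {a, b, c}"
  shows "orthogonal_bitrade (coset_circ G A B C) (coset_star G a A B C) \<longleftrightarrow>
           card (C \<inter> conj_subset G C a) = 1"
proof -
  interpret group G by fact
  have sgA: "subgroup A G" and sgB: "subgroup B G" and sgC: "subgroup C G"
    using assms(3-5) unfolding assms(9-11) by (auto intro: generate_is_subgroup)
  note lc = lcos_eq_iff[OF sgA] lcos_eq_iff[OF sgB] lcos_eq_iff[OF sgC]
  have AB: "x = \<one>" if "x \<in> A" "x \<in> B" for x
    using that assms(13) subgroup_Int_trivial_iff[OF sgA sgB] by blast
  have AC: "x = \<one>" if "x \<in> A" "x \<in> C" for x
    using that assms(14) subgroup_Int_trivial_iff[OF sgA sgC] by blast
  have BC: "x = \<one>" if "x \<in> B" "x \<in> C" for x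
    using that assms(15) subgroup_Int_trivial_iff[OF sgB sgC] by blast
  have C_sub: "C \<subseteq> carrier G" using sgC by (rule subgroup.subset)
  \<comment> \<open>The quotient of the two representatives,
    \<open>inv (h \<otimes> inv a) \<otimes> (g \<otimes> inv a)\<close>, equals
    \<open>a \<otimes> (inv h \<otimes> g) \<otimes> inv a\<close>.\<close>
  have conj: "(g \<otimes> inv a) <# C = (h \<otimes> inv a) <# C \<longleftrightarrow> a \<otimes> (inv h \<otimes> g) \<otimes> inv a \<in> C"
    if "g \<in> carrier G" "h \<in> carrier G" for g h
    using that assms(3) by (simp add: lc inv_mult_group m_assoc)
  have rep: "g = h" if "g \<in> carrier G" "h \<in> carrier G" "g <# A = h <# A" "g <# B = h <# B" for g h
  proof -
    have "inv h \<otimes> g = \<one>" using that by (intro AB) (simp_all add: lc)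
    then show ?thesis using that by (simp add: inv_solve_left')
  qed
  \<comment> \<open>Elementwise form of the triviality of
    \<open>C \<inter> conj_subset G C a\<close>.\<close>
  let ?P = "\<forall>x\<in>C. a \<otimes> x \<otimes> inv a \<in> C \<longrightarrow> x = \<one>"
  have "orthogonal_bitrade (coset_circ G A B C) (coset_star G a A B C) \<longleftrightarrow> ?P"
  proof
    assume orth: "orthogonal_bitrade (coset_circ G A B C) (coset_star G a A B C)"
    show ?P
    proof (intro ballI impI)
      fix x assume x: "x \<in> C" "a \<otimes> x \<otimes> inv a \<in> C"
      have xG: "x \<in> carrier G" using x(1) C_sub by blast
      have circ: "(g <# A, g <# B, g <# C) \<in> coset_circ G A B C"
        and star: "(g <# A, g <# B, (g \<otimes> inv a) <# C) \<in> coset_star G a A B C"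
        if "g \<in> carrier G" for g
        using that by (auto simp: coset_circ_def coset_star_def)
      \<comment> \<open>The cells given by \<open>x\<close> and by \<open>\<one>\<close> carry the
        same symbol in each square, so orthogonality forces them to share a row or a column.\<close>
      have "x <# C = \<one> <# C" using x(1) xG by (simp add: lc)
      moreover have "(x \<otimes> inv a) <# C = (\<one> \<otimes> inv a) <# C" using x(2) xG conj[of x \<one>] by simp
      ultimately have "x <# A = \<one> <# A \<or> x <# B = \<one> <# B"
        using orth circ[OF xG] circ[OF one_closed] star[OF xG] star[OF one_closed]
        unfolding orthogonal_bitrade_def by metis
      then have "x \<in> A \<or> x \<in> B" using xG by (simp add: lc)
      then show "x = \<one>" using AC BC x(1) by blast
    qed
  next
    assume P: ?P
    show "orthogonal_bitrade (coset_circ G A B C) (coset_star G a A B C)"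
      unfolding orthogonal_bitrade_def
    proof (intro allI impI notI, elim conjE)
      fix i j i' j' k l l'
      assume T: "(i, j, k) \<in> coset_circ G A B C" "(i', j', k) \<in> coset_circ G A B C"
        and ne: "i \<noteq> i'"
        and U: "(i, j, l) \<in> coset_star G a A B C" "(i', j', l') \<in> coset_star G a A B C"
        and eq: "l = l'"
      obtain g where g: "g \<in> carrier G" "i = g <# A" "j = g <# B" "k = g <# C"
        using T(1) by (auto simp: coset_circ_def)
      obtain h where h: "h \<in> carrier G" "i' = h <# A" "j' = h <# B" "k = h <# C"
        using T(2) by (auto simp: coset_circ_def)
      \<comment> \<open>Membership in the second square only provides some representative of the
        cell; by \<open>rep\<close> the row and column force it to be \<open>g\<close>.\<close>
      have l: "l = (g \<otimes> inv a) <# C" using U(1) g rep by (auto simp: coset_star_def)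
      have l': "l' = (h \<otimes> inv a) <# C" using U(2) h rep by (auto simp: coset_star_def)
      have "inv h \<otimes> g \<in> C" using g(4) h(4) lcos_eq_iff[OF sgC g(1) h(1)] by simp
      moreover have "a \<otimes> (inv h \<otimes> g) \<otimes> inv a \<in> C" using l l' eq conj[OF g(1) h(1)] by simp
      ultimately have "inv h \<otimes> g = \<one>" using P by blast
      \<comment> \<open>The quotient \<open>\<one>\<close> lies in \<open>A\<close>, so both cells
        lie in the same row.\<close>
      then have "i = i'" using g h sgA by (simp add: lc subgroup.one_closed)
      then show False using ne by blast
    qed
  qed
  also have "?P \<longleftrightarrow> (\<forall>x\<in>C. x \<in> conj_subset G C a \<longrightarrow> x = \<one>)"
    using mem_conj_subset_iff[OF C_sub assms(3)] C_sub by blast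
  also have "\<dots> \<longleftrightarrow> card (C \<inter> conj_subset G C a) = 1"
    using subgroup_Int_trivial_iff[OF sgC subgroup_conj_subset[OF sgC assms(3)]] by simp
  finally show ?thesis .
qed

end
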